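(* Let $A_1,\dots,A_n,B$ be real symmetric matrices of the same order and $c\in\mathbb{R}^n$. Consider $$(SDP)\quad \min\Big\{\sum_{i=1}^n c_ix_i:\ \sum_{i=1}^n A_ix_i\succeq B,\ x\in\mathbb{R}^n\Big\}$$ and $$(DSDP)\quad \max\big\{B\cdot Y:\ A_i\cdot Y=c_i\ \forall i\in\{1,\dots,n\},\ Y\succeq 0\big\}.$$ If $(SDP)$ is bounded and has a strictly feasible solution, then the optimal values of $(SDP)$ and $(DSDP)$ are equal and $(DSDP)$ reaches this optimum value. If $(SDP)$ is unbounded, then $(DSDP)$ is infeasible.
   Context: $M\succeq N$ means that $M-N$ is symmetric positive semidefinite, $M\succ N$ that $M-N$ is symmetric positive definite; $M\cdot N=\sum_{i,j}M_{ij}N_{ij}$. The variable $Y$ is a real symmetric matrix. The optimal value of $(SDP)$ is the infimum of its objective over feasible points (not necessarily attained), that of $(DSDP)$ is the supremum. "Bounded" means the infimum of $(SDP)$ is not $-\infty$, "unbounded" means it is $-\infty$. A strictly feasible solution of $(SDP)$ is an $x\in\mathbb{R}^n$ with $\sum_{i=1}^n A_ix_i\succ B$. *)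

theory Defs
  imports "HOL-Analysis.Analysis"
begin

definition psd :: "real ^ 'm ^ 'm \<Rightarrow> bool" where
  "psd M \<longleftrightarrow> transpose M = M \<and> (\<forall>v. 0 \<le> v \<bullet> (M *v v))"

definition pd :: "real ^ 'm ^ 'm \<Rightarrow> bool" where
  "pd M \<longleftrightarrow> transpose M = M \<and> (\<forall>v. v \<noteq> 0 \<longrightarrow> 0 < v \<bullet> (M *v v))"

definition loewner_ge :: "real ^ 'm ^ 'm \<Rightarrow> real ^ 'm ^ 'm \<Rightarrow> bool"  (infix "\<succeq>" 50) where
  "M \<succeq> N \<longleftrightarrow> psd (M - N)"

definition loewner_gt :: "real ^ 'm ^ 'm \<Rightarrow> real ^ 'm ^ 'm \<Rightarrow> bool"  (infix "\<succ>" 50) where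
  "M \<succ> N \<longleftrightarrow> pd (M - N)"

definition sdp_feasible :: "('n::finite \<Rightarrow> real ^ 'm ^ 'm) \<Rightarrow> real ^ 'm ^ 'm \<Rightarrow> (real ^ 'n) set" where
  "sdp_feasible A B = {x. (\<Sum>i\<in>UNIV. (x $ i) *\<^sub>R A i) \<succeq> B}"

definition sdp_strictly_feasible :: "('n::finite \<Rightarrow> real ^ 'm ^ 'm) \<Rightarrow> real ^ 'm ^ 'm \<Rightarrow> (real ^ 'n) set" where
  "sdp_strictly_feasible A B = {x. (\<Sum>i\<in>UNIV. (x $ i) *\<^sub>R A i) \<succ> B}"

text \<open>
  The inner product of \<open>real ^ 'm ^ 'm\<close> is the entrywise (Frobenius) one, the sum of
  \<open>M $ i $ j * N $ i $ j\<close> over all \<open>i\<close> and \<open>j\<close>; see \<open>inner_matrix\<close>.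
\<close>

lemma inner_matrix:
  fixes M N :: "real ^ 'm ^ 'm"
  shows "M \<bullet> N = (\<Sum>i\<in>UNIV. \<Sum>j\<in>UNIV. M $ i $ j * N $ i $ j)"
  by (simp add: inner_vec_def)

definition dsdp_feasible :: "('n::finite \<Rightarrow> real ^ 'm ^ 'm) \<Rightarrow> real ^ 'n \<Rightarrow> (real ^ 'm ^ 'm) set" where
  "dsdp_feasible A c = {Y. (\<forall>i. A i \<bullet> Y = c $ i) \<and> Y \<succeq> 0}"

text \<open>
  Optimal values are extended reals: an infeasible minimisation problem has value \<open>\<infinity>\<close>,
  an infeasible maximisation problem has value \<open>-\<infinity>\<close>.
\<close>

definition sdp_value :: "('n::finite \<Rightarrow> real ^ 'm ^ 'm) \<Rightarrow> real ^ 'm ^ 'm \<Rightarrow> real ^ 'n \<Rightarrow> ereal" where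
  "sdp_value A B c = (INF x\<in>sdp_feasible A B. ereal (\<Sum>i\<in>UNIV. c $ i * x $ i))"

definition dsdp_value :: "('n::finite \<Rightarrow> real ^ 'm ^ 'm) \<Rightarrow> real ^ 'm ^ 'm \<Rightarrow> real ^ 'n \<Rightarrow> ereal" where
  "dsdp_value A B c = (SUP Y\<in>dsdp_feasible A c. ereal (B \<bullet> Y))"

definition sdp_unbounded :: "('n::finite \<Rightarrow> real ^ 'm ^ 'm) \<Rightarrow> real ^ 'm ^ 'm \<Rightarrow> real ^ 'n \<Rightarrow> bool" where
  "sdp_unbounded A B c \<longleftrightarrow> sdp_value A B c = -\<infinity>"

definition sdp_bounded :: "('n::finite \<Rightarrow> real ^ 'm ^ 'm) \<Rightarrow> real ^ 'm ^ 'm \<Rightarrow> real ^ 'n \<Rightarrow> bool" where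
  "sdp_bounded A B c \<longleftrightarrow> sdp_value A B c \<noteq> -\<infinity>"

end

theory Submission
  imports Defs
begin

text \<open>
  Weak duality is the inequality \<open>M \<bullet> Y \<ge> 0\<close> for psd \<open>M\<close> and \<open>Y\<close>; it also excludes a dual
  feasible point when the primal is unbounded. For strong duality let \<open>p\<close> be the primal value and
  separate \<open>0\<close> from the convex set of all \<open>(M, r)\<close> for which some \<open>x\<close> makes
  \<open>\<Sum> x\<^sub>i A\<^sub>i - B + M\<close> positive semidefinite with \<open>c \<bullet> x - p < r\<close>. The separating functional
  \<open>(Z, t)\<close> has \<open>Z\<close> psd and \<open>t \<ge> 0\<close>, strict feasibility forces \<open>t > 0\<close>, and \<open>Z / t\<close> is a dual optimum.
\<close>

section \<open>Quadratic forms and the self-duality of the psd cone\<close>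

definition outer :: "real ^ 'm \<Rightarrow> real ^ 'm ^ 'm" where
  "outer v = (\<chi> i j. v $ i * v $ j)"

lemma inner_matrix_vector:
  fixes M :: "real ^ 'm ^ 'm"
  shows "u \<bullet> (M *v v) = (\<Sum>i\<in>UNIV. \<Sum>j\<in>UNIV. M $ i $ j * (u $ i * v $ j))"
  by (simp add: inner_vec_def matrix_vector_mult_def sum_distrib_left algebra_simps)

lemma inner_outer:
  fixes M :: "real ^ 'm ^ 'm"
  shows "M \<bullet> outer v = v \<bullet> (M *v v)"
  by (simp add: inner_matrix inner_matrix_vector outer_def)

lemma outer_mult_vector: "outer u *v v = (u \<bullet> v) *\<^sub>R u"
  by (simp add: vec_eq_iff outer_def matrix_vector_mult_def inner_vec_def sum_distrib_left
      sum_distrib_right algebra_simps)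

lemma transpose_outer: "transpose (outer v) = outer v"
  by (simp add: outer_def transpose_def vec_eq_iff mult.commute)

lemma transpose_diff:
  fixes M N :: "real ^ 'm ^ 'n"
  shows "transpose (M - N) = transpose M - transpose N"
  by (simp add: transpose_def vec_eq_iff)

lemma transpose_sum:
  fixes f :: "'i \<Rightarrow> real ^ 'm ^ 'n"
  shows "transpose (sum f S) = (\<Sum>i\<in>S. transpose (f i))"
  by (simp add: transpose_def vec_eq_iff)

lemma inner_transpose:
  fixes M N :: "real ^ 'm ^ 'm"
  shows "transpose M \<bullet> N = M \<bullet> transpose N"
  unfolding inner_matrix by (subst sum.swap) (simp add: transpose_def)

lemma symmetric_inner_commute:
  fixes M :: "real ^ 'm ^ 'm"
  assumes "transpose M = M"
  shows "u \<bullet> (M *v v) = v \<bullet> (M *v u)"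
  by (metis assms dot_lmul_matrix inner_commute transpose_matrix_vector)

text \<open>The quadratic form at \<open>v + s *\<^sub>R u\<close> is a nonnegative polynomial in
  \<open>s\<close>, so its discriminant is nonpositive; the form may be degenerate.\<close>

lemma psd_Cauchy_Schwarz:
  fixes M :: "real ^ 'm ^ 'm"
  assumes "psd M"
  shows "(u \<bullet> (M *v v))\<^sup>2 \<le> (u \<bullet> (M *v u)) * (v \<bullet> (M *v v))"
proof -
  have sym: "v \<bullet> (M *v u) = u \<bullet> (M *v v)"
    using assms symmetric_inner_commute unfolding psd_def by blast
  define a b d where "a = u \<bullet> (M *v u)" and "b = u \<bullet> (M *v v)" and "d = v \<bullet> (M *v v)"
  have quad: "0 \<le> d + 2 * s * b + s\<^sup>2 * a" for s
  proof -
    have "0 \<le> (v + s *\<^sub>R u) \<bullet> (M *v (v + s *\<^sub>R u))"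
      using assms unfolding psd_def by blast
    also have "\<dots> = d + 2 * s * b + s\<^sup>2 * a"
      unfolding a_def b_def d_def
      by (simp add: matrix_vector_right_distrib matrix_vector_mult_scaleR inner_add sym
          power2_eq_square algebra_simps)
    finally show ?thesis .
  qed
  have "a \<ge> 0" using assms unfolding psd_def a_def by blast
  have "b\<^sup>2 \<le> a * d"
  proof (cases "a = 0")
    case True
    have "b = 0"
    proof (rule ccontr)
      assume "b \<noteq> 0"
      \<comment> \<open>With \<open>a = 0\<close> the polynomial is affine with slope
        \<open>2 * b\<close>; at this \<open>s\<close> it equals -1.\<close>
      then show False using quad[of "- (d + 1) / (2 * b)"] True by (simp add: field_simps)
    qed
    with True show ?thesis by simp
  next
    case False
    then show ?thesis
      \<comment> \<open>This is the minimiser of the polynomial.\<close>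
      using quad[of "- b / a"] \<open>a \<ge> 0\<close> by (simp add: field_simps power2_eq_square)
  qed
  then show ?thesis unfolding a_def b_def d_def .
qed

text \<open>One step of Cholesky elimination removes a nonzero row from \<open>M\<close> and splits off a rank-one
  term, whose pairing with \<open>Y\<close> is a value of the quadratic form of \<open>Y\<close>; this replaces the
  spectral theorem.\<close>

lemma psd_inner_nonneg:
  fixes M Y :: "real ^ 'm ^ 'm"
  assumes "psd M" "psd Y"
  shows "0 \<le> M \<bullet> Y"
  using assms(1)
proof (induction "card {i. M $ i \<noteq> 0}" arbitrary: M rule: less_induct)
  case (less M)
  have sym: "transpose M = M" using less.prems unfolding psd_def by blast
  show ?case
  proof (cases "M = 0")
    case True
    then show ?thesis by simp
  next
    case False
    then obtain k where k: "M $ k \<noteq> 0" by (auto simp: vec_eq_iff)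
    define e where "e = (axis k 1 :: real ^ 'm)"
    define u where "u = M *v e"
    define a where "a = M $ k $ k"
    have e_M: "e \<bullet> (M *v v) = (M *v v) $ k" for v
      unfolding e_def by (simp add: inner_axis' )
    have u_nth: "u $ i = M $ i $ k" for i
      unfolding u_def e_def by (simp add: matrix_vector_mult_basis column_def)
    have M_swap: "M $ i $ j = M $ j $ i" for i j
      using sym by (metis transpose_def vec_lambda_beta)
    \<comment> \<open>This bound serves twice: it shows that the pivot \<open>a\<close> is nonzero,
      and that the form stays nonnegative after the elimination.\<close>
    have CS: "((M *v v) $ k)\<^sup>2 \<le> a * (v \<bullet> (M *v v))" for v
      using psd_Cauchy_Schwarz[OF less.prems, of e v] u_nth[of k]
      unfolding e_M a_def u_def by simp
    have Mv_k: "(M *v v) $ k = u \<bullet> v" for v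
      using symmetric_inner_commute[OF sym, of e v] e_M unfolding u_def
      by (simp add: inner_commute)
    have "a \<noteq> 0"
    proof
      assume "a = 0"
      then have "(M *v v) $ k = 0" for v using CS[of v] by simp
      then have "u \<bullet> v = 0" for v by (simp add: Mv_k)
      then have "u = 0" by (metis inner_eq_zero_iff)
      then have "M $ k = 0" using u_nth M_swap by (simp add: vec_eq_iff)
      with k show False by simp
    qed
    moreover have "a \<ge> 0"
      using less.prems e_M[of e] u_nth[of k] unfolding psd_def a_def u_def by metis
    ultimately have "a > 0" by simp
    define N where "N = M - (1 / a) *\<^sub>R outer u"
    have "psd N"
      unfolding psd_def
    proof (intro conjI allI)
      show "transpose N = N"
        unfolding N_def by (simp add: transpose_diff transpose_scalar sym transpose_outer)
    next
      fix v
      have "v \<bullet> (N *v v) = v \<bullet> (M *v v) - (u \<bullet> v)\<^sup>2 / a"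
        unfolding N_def
        by (simp add: matrix_vector_mult_diff_rdistrib scaleR_matrix_vector_assoc[symmetric]
            outer_mult_vector inner_diff_right power2_eq_square inner_commute)
      moreover have "(u \<bullet> v)\<^sup>2 / a \<le> v \<bullet> (M *v v)"
        using CS[of v] \<open>a > 0\<close> by (simp add: Mv_k field_simps)
      ultimately show "0 \<le> v \<bullet> (N *v v)" by simp
    qed
    have N_nth: "N $ i $ j = M $ i $ j - M $ i $ k * M $ j $ k / a" for i j
      unfolding N_def by (simp add: outer_def u_nth)
    \<comment> \<open>A zero row \<open>i\<close> of \<open>M\<close> has
      \<open>M $ i $ k = 0\<close> and hence stays zero, while row \<open>k\<close> becomes zero:
      the induction measure drops.\<close>
    have "{i. N $ i \<noteq> 0} \<subset> {i. M $ i \<noteq> 0}"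
    proof
      show "{i. N $ i \<noteq> 0} \<subseteq> {i. M $ i \<noteq> 0}"
        using N_nth by (force simp: vec_eq_iff)
      have "N $ k $ j = 0" for j
        using \<open>a \<noteq> 0\<close> M_swap[of j k] by (simp add: N_nth a_def)
      then have "N $ k = 0" by (simp add: vec_eq_iff)
      then show "{i. N $ i \<noteq> 0} \<noteq> {i. M $ i \<noteq> 0}" using k by auto
    qed
    then have "0 \<le> N \<bullet> Y"
      using less.hyps \<open>psd N\<close> by (simp add: psubset_card_mono)
    moreover have "M \<bullet> Y = N \<bullet> Y + (u \<bullet> (Y *v u)) / a"
      unfolding N_def using inner_outer[of Y u]
      by (simp add: inner_diff_left inner_commute[of "outer u"])
    moreover have "0 \<le> u \<bullet> (Y *v u)" using assms(2) unfolding psd_def by blast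
    ultimately show ?thesis using \<open>a > 0\<close> by simp
  qed
qed

text \<open>The test matrices \<open>N\<close> need not be symmetric. Skew ones have zero quadratic
  form and force \<open>Z\<close> to be symmetric; rank-one ones \<open>outer v\<close> give the
  sign of its form.\<close>

lemma psd_if_inner_nonneg:
  fixes Z :: "real ^ 'm ^ 'm"
  assumes "\<And>N. (\<And>v. 0 \<le> v \<bullet> (N *v v)) \<Longrightarrow> 0 \<le> Z \<bullet> N"
  shows "psd Z"
  unfolding psd_def
proof (intro conjI allI)
  have skew: "v \<bullet> ((transpose Z - Z) *v v) = 0" for v
    by (simp add: matrix_vector_mult_diff_rdistrib inner_diff_right)
      (metis dot_lmul_matrix inner_commute transpose_matrix_vector)
  \<comment> \<open>This says that the pairing of \<open>Z\<close> with its transpose is at least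
    \<open>Z \<bullet> Z\<close>, and the squared norm of \<open>transpose Z - Z\<close> is twice
    the difference \<open>Z \<bullet> Z - Z \<bullet> transpose Z\<close>.\<close>
  have "0 \<le> Z \<bullet> (transpose Z - Z)" by (rule assms) (simp add: skew)
  moreover have "transpose Z \<bullet> transpose Z = Z \<bullet> Z"
    by (simp add: inner_transpose)
  ultimately have "(transpose Z - Z) \<bullet> (transpose Z - Z) \<le> 0"
    by (simp add: inner_diff_left inner_diff_right inner_commute)
  then show "transpose Z = Z" by (metis eq_iff_diff_eq_0 inner_eq_zero_iff inner_ge_zero order_antisym)
next
  fix v :: "real ^ 'm"
  have "0 \<le> w \<bullet> (outer v *v w)" for w :: "real ^ 'm" by (simp add: outer_mult_vector inner_commute)
  then show "0 \<le> v \<bullet> (Z *v v)" using assms[of "outer v"] by (simp add: inner_outer)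
qed

text \<open>On the compact unit sphere the form of \<open>G\<close> has a positive minimum and that
  of \<open>Z\<close> is bounded above; homogeneity of degree two extends the estimate to all
  vectors. It provides the room around a strictly feasible point.\<close>

lemma pd_dominates:
  fixes G Z :: "real ^ 'm ^ 'm"
  assumes "pd G"
  obtains \<epsilon> where "\<epsilon> > 0" "\<And>v. 0 \<le> v \<bullet> ((G - \<epsilon> *\<^sub>R Z) *v v)"
proof -
  let ?S = "sphere (0 :: real ^ 'm) 1"
  have cont: "continuous_on ?S (\<lambda>v. v \<bullet> (M *v v))" for M :: "real ^ 'm ^ 'm"
    by (intro continuous_intros linear_continuous_on matrix_vector_mul_bounded_linear)
  have ne: "?S \<noteq> {}" by simp
  obtain v0 where v0: "v0 \<in> ?S" "\<And>v. v \<in> ?S \<Longrightarrow> v0 \<bullet> (G *v v0) \<le> v \<bullet> (G *v v)"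
    using continuous_attains_inf[OF compact_sphere ne cont] by blast
  obtain v1 where v1: "\<And>v. v \<in> ?S \<Longrightarrow> v \<bullet> (Z *v v) \<le> v1 \<bullet> (Z *v v1)"
    using continuous_attains_sup[OF compact_sphere ne cont] by blast
  \<comment> \<open>Adding 1 keeps \<open>K\<close> positive, so that \<open>\<delta> / K\<close> is
    positive and can serve as \<open>\<epsilon>\<close>.\<close>
  define \<delta> K where "\<delta> = v0 \<bullet> (G *v v0)" and "K = \<bar>v1 \<bullet> (Z *v v1)\<bar> + 1"
  have "v0 \<noteq> 0" using v0(1) by auto
  then have "\<delta> > 0" using assms unfolding pd_def \<delta>_def by blast
  have "K > 0" unfolding K_def by simp
  show ?thesis
  proof
    show "\<delta> / K > 0" using \<open>\<delta> > 0\<close> \<open>K > 0\<close> by simp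
  next
    fix v :: "real ^ 'm"
    let ?q = "\<lambda>v. v \<bullet> ((G - (\<delta> / K) *\<^sub>R Z) *v v)"
    have unit: "0 \<le> ?q w" if "w \<in> ?S" for w
    proof -
      have "w \<bullet> (Z *v w) \<le> K" using v1[OF that] unfolding K_def by linarith
      then have "(\<delta> / K) * (w \<bullet> (Z *v w)) \<le> (\<delta> / K) * K"
        using \<open>\<delta> > 0\<close> \<open>K > 0\<close> by (intro mult_left_mono) auto
      also have "\<dots> \<le> w \<bullet> (G *v w)" using v0(2)[OF that] \<open>K > 0\<close> unfolding \<delta>_def by simp
      finally show ?thesis
        by (simp add: matrix_vector_mult_diff_rdistrib scaleR_matrix_vector_assoc[symmetric]
            inner_diff_right)
    qed
    show "0 \<le> ?q v"
    proof (cases "v = 0")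
      case False
      have "?q v = (norm v)\<^sup>2 * ?q (v /\<^sub>R norm v)"
        using False by (simp add: matrix_vector_mult_scaleR power2_eq_square field_simps)
      moreover have "v /\<^sub>R norm v \<in> ?S" using False by simp
      ultimately show ?thesis using unit by (metis mult_nonneg_nonneg zero_le_power2)
    qed simp
  qed
qed

section \<open>Duality\<close>

lemma dsdp_feasible_iff: "Y \<in> dsdp_feasible A c \<longleftrightarrow> (\<forall>i. A i \<bullet> Y = c $ i) \<and> psd Y"
  by (simp add: dsdp_feasible_def loewner_ge_def)

lemma sdp_weak_duality:
  fixes A :: "'n::finite \<Rightarrow> real ^ 'm ^ 'm"
  assumes "x \<in> sdp_feasible A B" "Y \<in> dsdp_feasible A c"
  shows "B \<bullet> Y \<le> (\<Sum>i\<in>UNIV. c $ i * x $ i)"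
proof -
  have "0 \<le> ((\<Sum>i\<in>UNIV. x $ i *\<^sub>R A i) - B) \<bullet> Y"
    using assms by (intro psd_inner_nonneg)
      (auto simp: sdp_feasible_def dsdp_feasible_iff loewner_ge_def)
  also have "\<dots> = (\<Sum>i\<in>UNIV. c $ i * x $ i) - B \<bullet> Y"
    using assms(2) by (simp add: inner_diff_left inner_sum_left dsdp_feasible_iff mult.commute)
  finally show ?thesis by simp
qed

lemma dsdp_value_le_sdp_value: "dsdp_value A B c \<le> sdp_value A B c"
  unfolding dsdp_value_def sdp_value_def
  by (intro SUP_least INF_greatest) (simp add: sdp_weak_duality)

text \<open>Here \<open>p\<close> is any real lower bound of the primal objective. Taking
  \<open>p\<close> to be the primal value and using weak duality, the resulting \<open>Y\<close> is
  optimal.\<close>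

lemma sdp_dual_attained:
  fixes A :: "'n::finite \<Rightarrow> real ^ 'm ^ 'm" and B :: "real ^ 'm ^ 'm" and c :: "real ^ 'n"
  assumes symA: "\<And>i. transpose (A i) = A i" and symB: "transpose B = B"
    and strict: "x0 \<in> sdp_strictly_feasible A B"
    and bound: "\<And>x. x \<in> sdp_feasible A B \<Longrightarrow> p \<le> (\<Sum>i\<in>UNIV. c $ i * x $ i)"
  obtains Y where "Y \<in> dsdp_feasible A c" "p \<le> B \<bullet> Y"
proof -
  define G where "G x = (\<Sum>i\<in>UNIV. x $ i *\<^sub>R A i) - B" for x :: "real ^ 'n"
  define nn where "nn M \<longleftrightarrow> (\<forall>v. 0 \<le> v \<bullet> (M *v v))" for M :: "real ^ 'm ^ 'm"
  have symG: "transpose (G x) = G x" for x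
    unfolding G_def by (simp add: transpose_diff transpose_sum transpose_scalar symA symB)
  have nn_add: "nn (M + N)" if "nn M" "nn N" for M N
    using that unfolding nn_def by (simp add: matrix_vector_mult_add_rdistrib inner_add_right)
  have nn_scale: "nn (r *\<^sub>R M)" if "nn M" "r \<ge> 0" for M r
    using that unfolding nn_def by (simp add: scaleR_matrix_vector_assoc[symmetric])
  \<comment> \<open>\<open>G\<close> is affine rather than linear: the weights must sum to 1 for the
    constant \<open>B\<close> to match.\<close>
  have G_convex: "G (s *\<^sub>R x + t *\<^sub>R y) = s *\<^sub>R G x + t *\<^sub>R G y" if "s + t = 1" for s t x y
  proof -
    have "G z = (\<Sum>i\<in>UNIV. z $ i *\<^sub>R A i) - (s *\<^sub>R B + t *\<^sub>R B)" for z
      unfolding G_def by (simp add: that flip: scaleR_add_left)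
    from this[of "s *\<^sub>R x + t *\<^sub>R y"] show ?thesis
      unfolding G_def[of x] G_def[of y]
      by (simp add: scaleR_add_left sum.distrib scaleR_diff_right scaleR_sum_right)
  qed
  \<comment> \<open>\<open>M\<close> ranges over all matrices, not only symmetric ones, so that the separating functional
    cannot be a skew matrix, which vanishes on symmetric ones.\<close>
  define S where "S = {(M, r). \<exists>x. nn (G x + M) \<and> c \<bullet> x - p < r}"
  have "convex S"
    unfolding convex_def
  proof (clarify)
    fix M r N q and s t :: real
    assume "(M, r) \<in> S" "(N, q) \<in> S" and st: "s \<ge> 0" "t \<ge> 0" "s + t = 1"
    then obtain x y where x: "nn (G x + M)" "c \<bullet> x - p < r" and y: "nn (G y + N)" "c \<bullet> y - p < q"
      unfolding S_def by auto
    have "nn (s *\<^sub>R (G x + M) + t *\<^sub>R (G y + N))"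
      using x(1) y(1) st(1,2) by (blast intro: nn_add nn_scale)
    then have "nn (G (s *\<^sub>R x + t *\<^sub>R y) + (s *\<^sub>R M + t *\<^sub>R N))"
      using st by (simp add: G_convex algebra_simps)
    moreover have "c \<bullet> (s *\<^sub>R x + t *\<^sub>R y) - p < s * r + t * q"
    proof -
      \<comment> \<open>Both gaps are positive and the weights are not both zero, so the strict
        inequality survives the convex combination.\<close>
      have "0 < s * (r - (c \<bullet> x - p)) + t * (q - (c \<bullet> y - p))"
      proof (cases "s = 0")
        case True
        then show ?thesis using st(3) y(2) by simp
      next
        case False
        then show ?thesis
          using st x(2) y(2) by (intro add_pos_nonneg mult_pos_pos mult_nonneg_nonneg) auto
      qed
      also have "\<dots> = s * r + t * q + (s + t) * p - c \<bullet> (s *\<^sub>R x + t *\<^sub>R y)"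
        by (simp add: inner_add_right algebra_simps)
      finally show ?thesis using st(3) by simp
    qed
    ultimately show "s *\<^sub>R (M, r) + t *\<^sub>R (N, q) \<in> S" unfolding S_def by auto
  qed
  moreover have "0 \<notin> S"
  proof
    assume "0 \<in> S"
    then obtain x where x: "nn (G x)" "c \<bullet> x < p" unfolding S_def by (auto simp: zero_prod_def)
    then have "x \<in> sdp_feasible A B"
      using symG[of x] unfolding sdp_feasible_def loewner_ge_def psd_def nn_def G_def by simp
    with bound x(2) show False by (fastforce simp: inner_vec_def)
  qed
  ultimately obtain a where "a \<noteq> 0" "\<forall>z\<in>S. 0 \<le> a \<bullet> z"
    using separating_hyperplane_set_0 by blast
  then obtain Z t where Zt: "(Z, t) \<noteq> 0"
    and sep': "\<And>z. z \<in> S \<Longrightarrow> 0 \<le> (Z, t) \<bullet> z" by (cases a) auto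
  have sep: "0 \<le> Z \<bullet> M + t * r" if "nn (G x + M)" "c \<bullet> x - p < r" for x M r
    using sep'[of "(M, r)"] that unfolding S_def by auto
  \<comment> \<open>An affine function that is nonnegative on the positive half-line has nonnegative
    slope. It is applied to the rays of \<open>S\<close> and, at the end, to the dual
    residual.\<close>
  have unbounded_dir: "0 \<le> b" if "\<And>l. l > 0 \<Longrightarrow> 0 \<le> d + l * b" for b d :: real
  proof (rule ccontr)
    assume "\<not> 0 \<le> b"
    then have "d + ((\<bar>d\<bar> + 1) / - b) * b < 0" and "(\<bar>d\<bar> + 1) / - b > 0"
      by (auto simp: divide_less_0_iff)
    with that show False by (meson not_less)
  qed
  have nn0: "nn 0" unfolding nn_def by simp
  have "t \<ge> 0"
  proof (rule unbounded_dir)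
    fix l :: real assume "l > 0"
    \<comment> \<open>The choice \<open>x = 0\<close>, \<open>M = - G 0\<close> makes the matrix
      constraint trivial, and any \<open>r\<close> above \<open>- p\<close> is then allowed.\<close>
    then show "0 \<le> (Z \<bullet> (- G 0) + t * (- p)) + l * t"
      using sep[of 0 "- G 0" "l - p"] nn0 by (simp add: algebra_simps)
  qed
  have "0 \<le> Z \<bullet> N" if "nn N" for N
  proof (rule unbounded_dir)
    fix l :: real assume "l > 0"
    then show "0 \<le> (Z \<bullet> (- G 0) + t * (1 - p)) + l * (Z \<bullet> N)"
      using sep[of 0 "- G 0 + l *\<^sub>R N" "1 - p"] nn_scale[OF that, of l]
      by (simp add: inner_diff_right algebra_simps)
  qed
  then have "psd Z" by (intro psd_if_inner_nonneg) (simp add: nn_def)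
  have "t \<noteq> 0"
  proof
    assume "t = 0"
    then have "Z \<noteq> 0" using Zt by (simp add: zero_prod_def)
    have "pd (G x0)" using strict unfolding sdp_strictly_feasible_def loewner_gt_def G_def by simp
    \<comment> \<open>Strict feasibility admits a small move against \<open>Z\<close> itself; with
      \<open>t = 0\<close> separation then reads
      \<open>- \<epsilon> * (Z \<bullet> Z) \<ge> 0\<close>.\<close>
    then obtain \<epsilon> where "\<epsilon> > 0" "nn (G x0 - \<epsilon> *\<^sub>R Z)"
      using pd_dominates[of "G x0" Z] unfolding nn_def by metis
    then have "0 \<le> - (\<epsilon> * (Z \<bullet> Z))"
      using sep[of x0 "- (\<epsilon> *\<^sub>R Z)" "c \<bullet> x0 - p + 1"] \<open>t = 0\<close> by simp
    with \<open>\<epsilon> > 0\<close> have "Z \<bullet> Z \<le> 0" by (simp add: mult_le_0_iff)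
    with \<open>Z \<noteq> 0\<close> show False by (metis inner_gt_zero_iff not_le)
  qed
  with \<open>t \<ge> 0\<close> have "t > 0" by simp
  define Y where "Y = (1 / t) *\<^sub>R Z"
  have tY: "Z \<bullet> M = t * (Y \<bullet> M)" for M unfolding Y_def using \<open>t > 0\<close> by simp
  \<comment> \<open>Take \<open>M = - G x\<close> and let \<open>r\<close> tend to
    \<open>c \<bullet> x - p\<close> from above; the slack \<open>e\<close> is there because
    \<open>S\<close> is defined by a strict inequality.\<close>
  have lagrange: "Y \<bullet> G x \<le> c \<bullet> x - p" for x
  proof (rule field_le_epsilon)
    fix e :: real assume "e > 0"
    then have "0 \<le> t * (- (Y \<bullet> G x) + (c \<bullet> x - p + e))"
      using sep[of x "- G x" "c \<bullet> x - p + e"] nn0 by (simp add: tY algebra_simps)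
    then show "Y \<bullet> G x \<le> c \<bullet> x - p + e" using \<open>t > 0\<close> by (simp add: zero_le_mult_iff)
  qed
  \<comment> \<open>\<open>d\<close> is the residual of the dual equations. A linear function
    bounded below on the whole space vanishes, which is seen along \<open>- d\<close>.\<close>
  define d where "d = c - (\<chi> i. A i \<bullet> Y)"
  have "Y \<bullet> G x = (\<chi> i. A i \<bullet> Y) \<bullet> x - B \<bullet> Y" for x
    unfolding G_def by (simp add: inner_diff_right inner_sum_right inner_vec_def[of "\<chi> i. A i \<bullet> Y"]
        inner_commute[of Y] mult.commute)
  then have affine: "p - B \<bullet> Y \<le> d \<bullet> x" for x
    using lagrange[of x] unfolding d_def by (simp add: inner_diff_left)
  have "0 \<le> - (d \<bullet> d)"
  proof (rule unbounded_dir)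
    fix l :: real
    show "0 \<le> (B \<bullet> Y - p) + l * (- (d \<bullet> d))" using affine[of "- (l *\<^sub>R d)"] by simp
  qed
  then have "d = 0" by (metis inner_eq_zero_iff inner_ge_zero neg_0_le_iff_le order_antisym)
  have "psd Y"
    using \<open>psd Z\<close> \<open>t > 0\<close> unfolding psd_def Y_def
    by (simp add: transpose_scalar scaleR_matrix_vector_assoc[symmetric])
  show ?thesis
  proof
    show "Y \<in> dsdp_feasible A c"
      using \<open>psd Y\<close> \<open>d = 0\<close> unfolding dsdp_feasible_iff d_def by (simp add: vec_eq_iff)
    show "p \<le> B \<bullet> Y" using affine[of 0] by simp
  qed
qed

theorem theorem3:
  fixes A :: "'n::finite \<Rightarrow> real ^ 'm ^ 'm"
    and B :: "real ^ 'm ^ 'm"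
    and c :: "real ^ 'n"
  assumes "\<And>i. transpose (A i) = A i"
    and "transpose B = B"
  shows "(sdp_bounded A B c \<and> sdp_strictly_feasible A B \<noteq> {} \<longrightarrow>
            sdp_value A B c = dsdp_value A B c \<and>
            (\<exists>Y\<in>dsdp_feasible A c. ereal (B \<bullet> Y) = dsdp_value A B c))
       \<and> (sdp_unbounded A B c \<longrightarrow> dsdp_feasible A c = {})"
proof (intro conjI impI)
  have le_dual: "ereal (B \<bullet> Y) \<le> dsdp_value A B c" if "Y \<in> dsdp_feasible A c" for Y
    unfolding dsdp_value_def using that by (rule SUP_upper)
  {
    assume "sdp_unbounded A B c"
    then show "dsdp_feasible A c = {}"
      \<comment> \<open>A dual feasible \<open>Y\<close> would put the real number
        \<open>B \<bullet> Y\<close> below minus infinity.\<close>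
      using le_dual dsdp_value_le_sdp_value[of A B c] unfolding sdp_unbounded_def
      by (auto dest: order_trans)
  }
  assume "sdp_bounded A B c \<and> sdp_strictly_feasible A B \<noteq> {}"
  then obtain x0 where bdd: "sdp_value A B c \<noteq> -\<infinity>" and x0: "x0 \<in> sdp_strictly_feasible A B"
    unfolding sdp_bounded_def by auto
  have le_obj: "sdp_value A B c \<le> ereal (\<Sum>i\<in>UNIV. c $ i * x $ i)" if "x \<in> sdp_feasible A B" for x
    unfolding sdp_value_def using that by (rule INF_lower)
  \<comment> \<open>Feasibility of \<open>x0\<close> excludes the value plus infinity, so the primal
    value is a real \<open>p\<close>.\<close>
  have "x0 \<in> sdp_feasible A B"
    using x0 unfolding sdp_feasible_def sdp_strictly_feasible_def loewner_ge_def loewner_gt_def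
      psd_def pd_def by (auto intro: less_imp_le) (metis inner_zero_left less_imp_le order_refl)
  with bdd le_obj obtain p where p: "sdp_value A B c = ereal p"
    by (cases "sdp_value A B c") auto
  obtain Y where Y: "Y \<in> dsdp_feasible A c" "p \<le> B \<bullet> Y"
    using sdp_dual_attained[OF assms x0, of p c] le_obj p by auto
  have "sdp_value A B c \<le> ereal (B \<bullet> Y)" using p Y(2) by simp
  then have eq: "ereal (B \<bullet> Y) = dsdp_value A B c" "sdp_value A B c = dsdp_value A B c"
    using le_dual[OF Y(1)] dsdp_value_le_sdp_value[of A B c] by (auto intro: antisym order_trans)
  show "sdp_value A B c = dsdp_value A B c" by (fact eq(2))
  show "\<exists>Y\<in>dsdp_feasible A c. ereal (B \<bullet> Y) = dsdp_value A B c" using Y(1) eq(1) by blast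
qed

end
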